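(* Let $\mathbf{k}$ be an algebraically closed field of characteristic zero. For a family $X( * )$ of algebras, let $\overline{O(X( * ))}$ be the Zariski closure of the union of the $GL(\mathbb V)$-orbits of all members of the family. Then the algebras (up to isomorphism) whose orbits are contained in these closures are exactly: - $\overline{O(\mathfrak{T}_{07}( * ))}$: all $\mathfrak{T}_{07}(\alpha)$ with $\alpha\in\mathbf{k}\setminus\{1\}$, and $\mathfrak{T}_{03}$, $\mathfrak{T}_{01}$, $\mathfrak{T}_{04}$, $\mathfrak{T}_{10}(1)$, $\mathbf{k}^2$; - $\overline{O(\mathfrak{T}_{08}( * ))}$: all $\mathfrak{T}_{08}(\alpha)$ with $\alpha\in\mathbf{k}\setminus\{2,\frac32\}$, and $\mathfrak{T}_{03}$, $\mathfrak{T}_{02}$, $\mathfrak{T}_{05}$, $\mathfrak{T}_{10}(2)$, $\mathfrak{T}_{07}(\frac32)$, $\mathbf{k}^2$; - $\overline{O(\mathfrak{T}_{10}( * ))}$: all $\mathfrak{T}_{10}(\alpha)$ with $\alpha\in\mathbf{k}$, and $\mathfrak{T}_{06}$, $\mathbf{k}^2$.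
   Context: Let $\mathbb V=\mathbf{k}^2$ as a vector space. $\mathcal{A}_2=\mathrm{Hom}(\mathbb V\otimes\mathbb V,\mathbb V)\cong\mathbf{k}^8$ carries the Zariski topology; $GL(\mathbb V)$ acts by $(g*\mu)(x\otimes y)=g\mu(g^{-1}x\otimes g^{-1}y)$, so that orbits correspond to isomorphism classes of $2$-dimensional algebras. The orbit of an algebra is the orbit of any multiplication $\mu\in\mathcal A_2$ representing it. All algebras below are terminal, and the closures are taken in the Zariski closed set $\mathfrak{T}_2\subset\mathcal{A}_2$ of all terminal multiplications (equivalently, in $\mathcal{A}_2$). Here a multiplication $\mathcal{P}$ is terminal if $[[[\mathcal{P},a],\mathcal{P}],\mathcal{P}]=0$ for every $a\in\mathbb V$, where: $[\mathcal A,a](x)=\mathcal{A}(a,x)$ for $\mathcal{A}$ bilinear and $a\in\mathbb V$; $[\mathcal{A},\mathcal{B}](x,y)=\mathcal{A}(\mathcal{B}(x,y))-\mathcal{B}(\mathcal{A}(x),y)-\mathcal{B}(x,\mathcal{A}(y))$ for $\mathcal{A}$ linear and $\mathcal{B}$ bilinear; and for $\mathcal{A},\mathcal{B}$ bilinear $$[\mathcal A,\mathcal B](x,y,z)=\mathcal A(\mathcal B(x,y),z)+\mathcal A(x,\mathcal B(y,z))+\mathcal A(y,\mathcal B(x,z))-\mathcal B(\mathcal A(x,y),z)-\mathcal B(x,\mathcal A(y,z))-\mathcal B(y,\mathcal A(x,z)).$$ Notation for algebras (basis $e_1,e_2$; unlisted products are zero); $\mathbf{k}^2$ denotes the algebra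 with zero multiplication. $\mathfrak{T}_{01}$: $e_1e_1=e_1+e_2$, $e_1e_2=e_2$. $\mathfrak{T}_{02}$: $e_1e_1=e_1+e_2$, $e_1e_2=2e_2$, $e_2e_1=-e_2$. $\mathfrak{T}_{03}$: $e_1e_1=e_2$. $\mathfrak{T}_{04}$: $e_2e_1=e_1$. $\mathfrak{T}_{05}$: $e_1e_2=2e_1$, $e_2e_1=-e_1$. $\mathfrak{T}_{06}$: $e_1e_2=e_2$, $e_2e_1=-e_2$. $\mathfrak{T}_{07}(\alpha)$, $\alpha\in\mathbf{k}\setminus\{1\}$: $e_1e_1=e_1$, $e_1e_2=\alpha e_2$. $\mathfrak{T}_{08}(\alpha)$, $\alpha\in\mathbf{k}\setminus\{2,\frac32\}$: $e_1e_1=e_1$, $e_1e_2=\alpha e_2$, $e_2e_1=(3-2\alpha)e_2$. $\mathfrak{T}_{10}(\alpha)$, $\alpha\in\mathbf{k}$: $e_1e_1=e_1$, $e_1e_2=(1-\alpha)e_1+\alpha e_2$, $e_2e_1=\alpha e_1+(1-\alpha)e_2$, $e_2e_2=e_2$. The families are $\mathfrak{T}_{07}( * )=\{\mathfrak{T}_{07}(\alpha):\alpha\in\mathbf{k}\setminus\{1\}\}$, $\mathfrak{T}_{08}( * )=\{\mathfrak{T}_{08}(\alpha):\alpha\in\mathbf{k}\setminus\{2,\frac32\}\}$, $\mathfrak{T}_{10}( * )=\{\mathfrak{T}_{10}(\alpha):\alpha\in\mathbf{k}\}$. *)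

theory Defs
  imports "HOL-Analysis.Analysis" "HOL-Computational_Algebra.Polynomial"
begin

type_synonym 'a mult = "'a^2 \<Rightarrow> 'a^2 \<Rightarrow> 'a^2"

text \<open>Linear maps \<open>V \<otimes> V \<rightarrow> V\<close> are encoded as bilinear maps in curried form.\<close>

definition A2 :: "'a::field mult set" where
  "A2 = {\<mu>. (\<forall>x. Vector_Spaces.linear (*s) (*s) (\<lambda>y. \<mu> x y)) \<and>
            (\<forall>y. Vector_Spaces.linear (*s) (*s) (\<lambda>x. \<mu> x y))}"

definition GLV :: "('a::field^2 \<Rightarrow> 'a^2) set" where
  "GLV = {g. Vector_Spaces.linear (*s) (*s) g \<and> bij g}"

definition act :: "('a::field^2 \<Rightarrow> 'a^2) \<Rightarrow> 'a mult \<Rightarrow> 'a mult" where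
  "act g \<mu> = (\<lambda>x y. g (\<mu> (inv g x) (inv g y)))"

definition orbit :: "'a::field mult \<Rightarrow> 'a mult set" where
  "orbit \<mu> = {act g \<mu> |g. g \<in> GLV}"

definition isomorphic :: "'a::field mult \<Rightarrow> 'a mult \<Rightarrow> bool" where
  "isomorphic \<mu> \<nu> \<longleftrightarrow> (\<exists>g\<in>GLV. \<forall>x y. g (\<mu> x y) = \<nu> (g x) (g y))"

definition bracket_vec :: "'a mult \<Rightarrow> 'a^2 \<Rightarrow> ('a^2 \<Rightarrow> 'a^2)" where
  "bracket_vec A a = (\<lambda>x. A a x)"

definition bracket_lin :: "('a::field^2 \<Rightarrow> 'a^2) \<Rightarrow> 'a mult \<Rightarrow> 'a mult" where
  "bracket_lin A B = (\<lambda>x y. A (B x y) - B (A x) y - B x (A y))"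

definition bracket_bil ::
  "'a::field mult \<Rightarrow> 'a mult \<Rightarrow> ('a^2 \<Rightarrow> 'a^2 \<Rightarrow> 'a^2 \<Rightarrow> 'a^2)" where
  "bracket_bil A B = (\<lambda>x y z.
     A (B x y) z + A x (B y z) + A y (B x z) - B (A x y) z - B x (A y z) - B y (A x z))"

definition terminal :: "'a::field mult \<Rightarrow> bool" where
  "terminal P \<longleftrightarrow>
     (\<forall>a. bracket_bil (bracket_lin (bracket_vec P a) P) P = (\<lambda>x y z. 0))"

definition T2 :: "'a::field mult set" where
  "T2 = {\<mu> \<in> A2. terminal \<mu>}"

text \<open>The functions on \<^const>\<open>A2\<close> that are polynomials in the eight structure constants.\<close>

inductive_set poly_funs :: "('a::field mult \<Rightarrow> 'a) set" where
  const: "(\<lambda>_. c) \<in> poly_funs"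
| coord: "(\<lambda>\<mu>. \<mu> (axis i 1) (axis j 1) $ k) \<in> poly_funs"
| add: "p \<in> poly_funs \<Longrightarrow> q \<in> poly_funs \<Longrightarrow> (\<lambda>\<mu>. p \<mu> + q \<mu>) \<in> poly_funs"
| mult: "p \<in> poly_funs \<Longrightarrow> q \<in> poly_funs \<Longrightarrow> (\<lambda>\<mu>. p \<mu> * q \<mu>) \<in> poly_funs"

definition zero_locus :: "('a::field mult \<Rightarrow> 'a) set \<Rightarrow> 'a mult set" where
  "zero_locus F = {\<mu> \<in> A2. \<forall>p\<in>F. p \<mu> = 0}"

definition zariski_open :: "'a::field mult set \<Rightarrow> bool" where
  "zariski_open U \<longleftrightarrow> (\<exists>F\<subseteq>poly_funs. U = A2 - zero_locus F)"

definition zariski :: "'a::field mult topology" where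
  "zariski = topology zariski_open"

lemma istopology_zariski_open: "istopology (zariski_open :: 'a::field mult set \<Rightarrow> bool)"
  unfolding istopology_def
proof (intro conjI allI impI)
  fix S T :: "'a mult set"
  assume "zariski_open S" "zariski_open T"
  then obtain F G where F: "F \<subseteq> poly_funs" "S = A2 - zero_locus F"
    and G: "G \<subseteq> poly_funs" "T = A2 - zero_locus G"
    unfolding zariski_open_def by blast
  define H where "H = {\<lambda>\<mu>. p \<mu> * q \<mu> |p q. p \<in> F \<and> q \<in> G}"
  have "H \<subseteq> poly_funs"
    using F(1) G(1) by (auto simp: H_def intro!: poly_funs.mult)
  moreover have "S \<inter> T = A2 - zero_locus H"
  proof
    show "S \<inter> T \<subseteq> A2 - zero_locus H"
    proof
      fix \<mu> assume "\<mu> \<in> S \<inter> T"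
      then obtain p q where pq: "\<mu> \<in> A2" "p \<in> F" "q \<in> G" "p \<mu> \<noteq> 0" "q \<mu> \<noteq> 0"
        using F(2) G(2) by (auto simp: zero_locus_def)
      then have "(\<lambda>\<mu>. p \<mu> * q \<mu>) \<in> H" by (auto simp: H_def)
      then show "\<mu> \<in> A2 - zero_locus H"
        using pq by (force simp: zero_locus_def)
    qed
    show "A2 - zero_locus H \<subseteq> S \<inter> T"
      using F(2) G(2) by (auto simp: zero_locus_def H_def)
  qed
  ultimately show "zariski_open (S \<inter> T)"
    unfolding zariski_open_def by blast
next
  fix K :: "'a mult set set"
  assume "\<forall>U\<in>K. zariski_open U"
  then obtain F where F: "\<And>U. U \<in> K \<Longrightarrow> F U \<subseteq> poly_funs \<and> U = A2 - zero_locus (F U)"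
    unfolding zariski_open_def by metis
  have "\<Union>K = (\<Union>U\<in>K. A2 - zero_locus (F U))"
    using F by auto
  also have "\<dots> = A2 - zero_locus (\<Union>U\<in>K. F U)"
    by (auto simp: zero_locus_def)
  finally have "\<Union>K = A2 - zero_locus (\<Union>U\<in>K. F U)" .
  moreover have "(\<Union>U\<in>K. F U) \<subseteq> poly_funs"
    using F by blast
  ultimately show "zariski_open (\<Union>K)"
    unfolding zariski_open_def by blast
qed

lemma openin_zariski: "openin zariski = zariski_open"
  unfolding zariski_def by (rule topology_inverse'[OF istopology_zariski_open])

lemma topspace_zariski: "topspace zariski = A2"
proof -
  have "zariski_open (A2 - zero_locus {\<lambda>_. 1 :: 'a::field})"
    unfolding zariski_open_def by (blast intro: poly_funs.const)
  then have "zariski_open (A2 :: 'a mult set)"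
    by (simp add: zero_locus_def)
  then show ?thesis
    unfolding topspace_def openin_zariski zariski_open_def by blast
qed

lemma closedin_zariski: "closedin zariski Z \<longleftrightarrow> (\<exists>F\<subseteq>poly_funs. Z = zero_locus F)"
proof -
  have "zero_locus F \<subseteq> A2" for F :: "('a mult \<Rightarrow> 'a) set"
    by (auto simp: zero_locus_def)
  then show ?thesis
    unfolding closedin_def openin_zariski topspace_zariski zariski_open_def
    by (metis Diff_Diff_Int Int_absorb1)
qed

text \<open>The closure, taken in the space of terminal multiplications, of the union of the
  orbits of the members of a family.\<close>

definition orbit_closure :: "'a::field mult set \<Rightarrow> 'a mult set" where
  "orbit_closure X = subtopology zariski T2 closure_of (\<Union>\<mu>\<in>X. orbit \<mu>)"

abbreviation e1 :: "'a::field^2" where "e1 \<equiv> axis 1 1"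
abbreviation e2 :: "'a::field^2" where "e2 \<equiv> axis 2 1"

text \<open>The bilinear map with prescribed values of \<open>e\<^sub>1e\<^sub>1\<close>, \<open>e\<^sub>1e\<^sub>2\<close>, \<open>e\<^sub>2e\<^sub>1\<close>, \<open>e\<^sub>2e\<^sub>2\<close>,
  in this order.\<close>

definition mult_table :: "'a::field^2 \<Rightarrow> 'a^2 \<Rightarrow> 'a^2 \<Rightarrow> 'a^2 \<Rightarrow> 'a mult" where
  "mult_table u11 u12 u21 u22 = (\<lambda>x y.
     (x$1 * y$1) *s u11 + (x$1 * y$2) *s u12 + (x$2 * y$1) *s u21 + (x$2 * y$2) *s u22)"

definition T01 :: "'a::field mult" where
  "T01 = mult_table (e1 + e2) e2 0 0"
definition T02 :: "'a::field mult" where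
  "T02 = mult_table (e1 + e2) (2 *s e2) (- e2) 0"
definition T03 :: "'a::field mult" where
  "T03 = mult_table e2 0 0 0"
definition T04 :: "'a::field mult" where
  "T04 = mult_table 0 0 e1 0"
definition T05 :: "'a::field mult" where
  "T05 = mult_table 0 (2 *s e1) (- e1) 0"
definition T06 :: "'a::field mult" where
  "T06 = mult_table 0 e2 (- e2) 0"
definition T07 :: "'a::field \<Rightarrow> 'a mult" where
  "T07 \<alpha> = mult_table e1 (\<alpha> *s e2) 0 0"
definition T08 :: "'a::field \<Rightarrow> 'a mult" where
  "T08 \<alpha> = mult_table e1 (\<alpha> *s e2) ((3 - 2 * \<alpha>) *s e2) 0"
definition T10 :: "'a::field \<Rightarrow> 'a mult" where
  "T10 \<alpha> = mult_table e1 ((1 - \<alpha>) *s e1 + \<alpha> *s e2) (\<alpha> *s e1 + (1 - \<alpha>) *s e2) e2"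

definition zero_mult :: "'a::field mult" where
  "zero_mult = (\<lambda>x y. 0)"

definition T07_family :: "'a::field mult set" where
  "T07_family = {T07 \<alpha> |\<alpha>. \<alpha> \<noteq> 1}"
definition T08_family :: "'a::field mult set" where
  "T08_family = {T08 \<alpha> |\<alpha>. \<alpha> \<notin> {2, 3/2}}"
definition T10_family :: "'a::field mult set" where
  "T10_family = {T10 \<alpha> |\<alpha>. True}"

end

theory Submission
  imports Defs
begin

text \<open>All multiplications in question have the shape
  \<open>\<mu>(x,y) = a \<phi>(x) y + b \<phi>(y) x + \<phi>(x) \<phi>(y) w\<close> with a linear form \<open>\<phi>\<close>, and in a basis with
  \<open>\<phi>(e\<^sub>1) = 1\<close>, \<open>\<phi>(e\<^sub>2) = 0\<close> they read \<open>e\<^sub>1e\<^sub>1 = l e\<^sub>1 + c e\<^sub>2\<close>, \<open>e\<^sub>1e\<^sub>2 = a e\<^sub>2\<close>, \<open>e\<^sub>2e\<^sub>1 = b e\<^sub>2\<close>.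
  The closures of the three families are the unions of the orbits of the linear spaces \<open>b = 0\<close>,
  \<open>b = 3 l - 2 a\<close>, and \<open>l = a + b, c = 0\<close> of such tables. A generic member of such a space is
  isomorphic to a member of the family, so that every orbit in it is reached along a line.
  Conversely, the orbits of each family satisfy quadratic equations; these hold on the whole orbit of
  a \<open>\<mu>\<close> in the closure, and a basis adapted to \<open>\<mu>\<close>, found by a swap and a shear, turns
  them into the linear conditions above.\<close>

lemma linear_iff_vec:
  "Vector_Spaces.linear (*s) (*s) (f :: 'a::field^2 \<Rightarrow> 'a^2) \<longleftrightarrow>
     (\<forall>x y. f (x + y) = f x + f y) \<and> (\<forall>c x. f (c *s x) = c *s f x)"
  using vec.vector_space_axioms by (auto simp: Vector_Spaces.linear_iff)

lemma axis_eqs [simp]: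
  "(axis 1 1 :: 'a::field^2) $ 1 = 1" "(axis 1 1 :: 'a^2) $ 2 = 0"
  "(axis 2 1 :: 'a^2) $ 1 = 0" "(axis 2 1 :: 'a^2) $ 2 = 1"
  by (auto simp: axis_def)

subsection \<open>Orbits\<close>

lemma GLV_id: "id \<in> GLV"
  by (auto simp: GLV_def linear_iff_vec)

lemma GLV_comp: "g \<in> GLV \<Longrightarrow> h \<in> GLV \<Longrightarrow> g \<circ> h \<in> GLV"
  by (auto simp: GLV_def linear_iff_vec intro: bij_comp)

lemma GLV_inv:
  assumes "g \<in> GLV" shows "inv g \<in> GLV"
proof -
  from assms have b: "bij g" and add: "g (x + y) = g x + g y" and sc: "g (c *s x) = c *s g x"
    for x y c by (auto simp: GLV_def linear_iff_vec)
  have "inv g (x + y) = inv g x + inv g y" for x y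
    using add[of "inv g x" "inv g y"] b
    by (metis bij_inv_eq_iff)
  moreover have "inv g (c *s x) = c *s inv g x" for x c
    using sc[of c "inv g x"] b by (metis bij_inv_eq_iff)
  ultimately show ?thesis using b by (auto simp: GLV_def linear_iff_vec bij_imp_bij_inv)
qed

lemma GLV_inv_apply [simp]: "g \<in> GLV \<Longrightarrow> inv g (g x) = x" "g \<in> GLV \<Longrightarrow> g (inv g x) = x"
  by (auto simp: GLV_def bij_is_inj bij_is_surj surj_f_inv_f)

lemma GLV_linear:
  assumes "g \<in> GLV"
  shows "g (x + y) = g x + g y" "g (c *s x) = c *s g x"
  using assms by (auto simp: GLV_def linear_iff_vec)

lemma act_act: "g \<in> GLV \<Longrightarrow> h \<in> GLV \<Longrightarrow> act g (act h \<mu>) = act (g \<circ> h) \<mu>"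
  by (auto simp: act_def GLV_def o_inv_distrib)

lemma orbit_refl [simp]: "\<mu> \<in> orbit \<mu>"
proof -
  have "\<mu> = act id \<mu>" by (simp add: act_def fun_eq_iff)
  then show ?thesis using GLV_id unfolding orbit_def by blast
qed

lemma orbit_trans: "\<nu> \<in> orbit \<mu> \<Longrightarrow> \<rho> \<in> orbit \<nu> \<Longrightarrow> \<rho> \<in> orbit \<mu>"
  unfolding orbit_def by (force simp: act_act dest: GLV_comp)

lemma orbit_sym:
  assumes "\<nu> \<in> orbit \<mu>" shows "\<mu> \<in> orbit \<nu>"
proof -
  obtain g where g: "g \<in> GLV" "\<nu> = act g \<mu>" using assms by (auto simp: orbit_def)
  then have "\<mu> = act (inv g) \<nu>"
    by (simp add: act_def fun_eq_iff GLV_def inv_inv_eq bij_is_inj)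
  then show ?thesis using GLV_inv[OF g(1)] by (auto simp: orbit_def)
qed

lemma orbit_eq: "\<nu> \<in> orbit \<mu> \<Longrightarrow> orbit \<nu> = orbit \<mu>"
  by (blast intro: orbit_trans orbit_sym)

lemma isomorphic_iff_orbit: "isomorphic \<mu> \<nu> \<longleftrightarrow> \<nu> \<in> orbit \<mu>"
proof
  assume "isomorphic \<mu> \<nu>"
  then obtain g where g: "g \<in> GLV" "\<And>x y. g (\<mu> x y) = \<nu> (g x) (g y)"
    by (auto simp: isomorphic_def)
  then have "\<nu> = act g \<mu>" by (simp add: act_def fun_eq_iff)
  then show "\<nu> \<in> orbit \<mu>" using g(1) by (auto simp: orbit_def)
next
  assume "\<nu> \<in> orbit \<mu>"
  then obtain g where g: "g \<in> GLV" "\<nu> = act g \<mu>" unfolding orbit_def by blast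
  then have "g (\<mu> x y) = \<nu> (g x) (g y)" for x y by (simp add: act_def)
  then show "isomorphic \<mu> \<nu>" using g(1) unfolding isomorphic_def by blast
qed

definition lmap :: "'a::field \<Rightarrow> 'a \<Rightarrow> 'a \<Rightarrow> 'a \<Rightarrow> 'a^2 \<Rightarrow> 'a^2" where
  "lmap p q r s x = (\<chi> i. if i = 1 then p * x$1 + q * x$2 else r * x$1 + s * x$2)"

lemma lmap_nth [simp]:
  "lmap p q r s x $ 1 = p * x$1 + q * x$2" "lmap p q r s x $ 2 = r * x$1 + s * x$2"
  by (auto simp: lmap_def)

lemma lmap_GLV:
  fixes p q r s :: "'a::field"
  assumes "p * s - q * r \<noteq> 0"
  shows "lmap p q r s \<in> GLV"
proof -
  define d where "d = p * s - q * r"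
  have d: "d \<noteq> 0" using assms by (simp add: d_def)
  let ?h = "lmap (s / d) (- q / d) (- r / d) (p / d)"
  have "?h (lmap p q r s x) = x" "lmap p q r s (?h x) = x" for x
    using d by (auto simp: vec_eq_iff forall_2 divide_simps) (auto simp: d_def algebra_simps)
  then have "bij (lmap p q r s)" by (intro o_bij[of ?h]) (auto simp: fun_eq_iff)
  then show ?thesis
    by (auto simp: GLV_def linear_iff_vec vec_eq_iff forall_2 algebra_simps)
qed

text \<open>The intertwining map goes from \<open>\<nu>\<close> to \<open>\<mu>\<close>, so an
  isomorphism is certified by its matrix alone, without computing an inverse.\<close>

lemma orbit_lmapI:
  fixes p q r s :: "'a::field"
  assumes "p * s - q * r \<noteq> 0"
    and "\<And>x y. lmap p q r s (\<nu> x y) = \<mu> (lmap p q r s x) (lmap p q r s y)"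
  shows "\<nu> \<in> orbit \<mu>"
  using lmap_GLV[OF assms(1)] assms(2)
  by (intro orbit_sym[of \<mu>]) (auto simp: isomorphic_iff_orbit[symmetric] isomorphic_def)

subsection \<open>The multiplications \<open>a \<phi>(x) y + b \<phi>(y) x + \<phi>(x) \<phi>(y) w\<close>\<close>

definition lin :: "'a::field^2 \<Rightarrow> 'a^2 \<Rightarrow> 'a" where
  "lin u x = u$1 * x$1 + u$2 * x$2"

lemma lin_simps [simp]:
  "lin u (x + y) = lin u x + lin u y" "lin u (x - y) = lin u x - lin u y"
  "lin u (c *s x) = c * lin u x" "lin u 0 = 0"
  by (auto simp: lin_def algebra_simps)

definition form :: "'a::field^2 \<Rightarrow> 'a^2 \<Rightarrow> 'a \<Rightarrow> 'a \<Rightarrow> 'a mult" where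
  "form u w a b = (\<lambda>x y. (a * lin u x) *s y + (b * lin u y) *s x + (lin u x * lin u y) *s w)"

lemma form_A2: "form u w a b \<in> A2"
  by (auto simp: form_def A2_def linear_iff_vec vec_eq_iff algebra_simps)

text \<open>The shape is stable under base change: \<phi> is composed with the inverse of
  \<open>g\<close>, and \<open>w\<close> is moved by \<open>g\<close>. Hence \<open>a\<close>,
  \<open>b\<close> and \<phi>(w) are constant along an orbit.\<close>

lemma act_form:
  assumes "g \<in> GLV"
  shows "\<exists>u'. act g (form u w a b) = form u' (g w) a b \<and> lin u' (g w) = lin u w"
proof -
  define u' :: "'a^2" where "u' = (\<chi> i. lin u (inv g (axis i 1)))"
  have i: "inv g (x + y) = inv g x + inv g y" "inv g (c *s x) = c *s inv g x" for x y c
    using GLV_linear[OF GLV_inv[OF assms]] by auto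
  have l: "lin u (inv g x) = lin u' x" for x
  proof -
    have "x = x$1 *s axis 1 1 + x$2 *s axis 2 1"
      by (simp add: vec_eq_iff forall_2)
    then have "lin u (inv g x) = lin u (inv g (x$1 *s axis 1 1 + x$2 *s axis 2 1))"
      by simp
    also have "\<dots> = lin u' x"
      unfolding i by (simp add: u'_def) (simp add: lin_def[of _ x] mult.commute)
    finally show ?thesis .
  qed
  have "lin u' (g w) = lin u w" using l[of "g w"] assms by simp
  moreover have "act g (form u w a b) = form u' (g w) a b"
    by (simp add: act_def form_def fun_eq_iff GLV_linear[OF assms] assms l)
  ultimately show ?thesis by blast
qed

text \<open>Only the second summand matters for terminality: a multiple of the multiplication has
  zero bracket with it. The vector \<phi>(w) p - \<phi>(p) w lies in the kernel of \<phi>.\<close>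

lemma bracket_lin_form:
  "bracket_lin (bracket_vec (form u w a b) p) (form u w a b) x y =
     (- (a + b + lin u w) * lin u p) *s form u w a b x y +
     (b * lin u x * lin u y) *s (lin u w *s p - lin u p *s w)"
  by (simp add: vec_eq_iff bracket_lin_def bracket_vec_def form_def algebra_simps)

lemma bracket_bil_form:
  "bracket_bil (bracket_lin (bracket_vec (form u w a b) p) (form u w a b)) (form u w a b) x y z =
     (b * (a + 2 * b + 3 * lin u w) * lin u x * lin u y * lin u z) *s (lin u w *s p - lin u p *s w)"
  unfolding bracket_bil_def bracket_lin_form
  by (simp add: vec_eq_iff form_def) (simp add: algebra_simps)

text \<open>Each alternative kills one factor in \<open>bracket_bil_form\<close>; in this order they
  belong to the families T07, T10 and T08.\<close>

lemma form_T2: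
  assumes "b = 0 \<or> w = 0 \<or> a + 2 * b + 3 * lin u w = 0"
  shows "form u w a b \<in> T2"
  using assms form_A2 by (auto simp: T2_def terminal_def bracket_bil_form fun_eq_iff)

section \<open>Tables in an adapted basis and their isomorphisms\<close>

definition tri :: "'a::field \<Rightarrow> 'a \<Rightarrow> 'a \<Rightarrow> 'a \<Rightarrow> 'a mult" where
  "tri l c a b = mult_table (l *s e1 + c *s e2) (a *s e2) (b *s e2) 0"

lemma tri_eq_form: "tri l c a b = form e1 ((l - a - b) *s e1 + c *s e2) a b"
  by (simp add: tri_def form_def mult_table_def fun_eq_iff vec_eq_iff forall_2 lin_def algebra_simps)

text \<open>The last conjunct is recorded separately because \<phi>(w) = 0 alone does not force
  \<open>w = 0\<close>, which the family T10 requires.\<close>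

lemma orbit_tri_form:
  assumes "\<nu> \<in> orbit (tri l c a b)"
  shows "\<exists>u w. \<nu> = form u w a b \<and> lin u w = l - a - b \<and> (l = a + b \<longrightarrow> c = 0 \<longrightarrow> w = 0)"
proof -
  obtain g where g: "g \<in> GLV" "\<nu> = act g (tri l c a b)" using assms by (auto simp: orbit_def)
  have "g 0 = 0" using GLV_linear(2)[OF g(1), of 0 0] by simp
  moreover obtain u' where "\<nu> = form u' (g ((l - a - b) *s e1 + c *s e2)) a b"
    "lin u' (g ((l - a - b) *s e1 + c *s e2)) = lin e1 ((l - a - b) *s e1 + c *s e2)"
    using act_form[OF g(1)] g(2) unfolding tri_eq_form by metis
  moreover have "lin e1 ((l - a - b) *s e1 + c *s e2) = l - a - b" by (simp add: lin_def)
  ultimately show ?thesis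
    by (intro exI[of _ u'] exI[of _ "g ((l - a - b) *s e1 + c *s e2)"]) auto
qed

lemma orbit_tri_T2:
  assumes "\<nu> \<in> orbit (tri l c a b)"
    and "b = 0 \<or> b = 3 * l - 2 * a \<or> l = a + b \<and> c = 0"
  shows "\<nu> \<in> T2"
proof -
  obtain u w where uw: "\<nu> = form u w a b" "lin u w = l - a - b"
    "l = a + b \<longrightarrow> c = 0 \<longrightarrow> w = 0"
    using orbit_tri_form[OF assms(1)] by blast
  have "a + 2 * b + 3 * lin u w = 0" if "b = 3 * l - 2 * a"
    unfolding uw(2) that by (simp add: algebra_simps)
  then show ?thesis using assms(2) uw(3) unfolding uw(1) by (intro form_T2) blast
qed

text \<open>The new basis is k e1 + s e2, m e2. The square of its first vector is k l times that
  vector plus a multiple of e2, and the third hypothesis matches this multiple with m c'.\<close>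

lemma orbit_triI:
  assumes "k \<noteq> 0" "m \<noteq> 0" "m * c' = k * k * c + k * s * (a + b - l)"
  shows "tri (k * l) c' (k * a) (k * b) \<in> orbit (tri l c a b)"
\<comment> \<open>The positional arguments run in the order \<open>p\<close>, \<open>s\<close>,
  \<open>q\<close>, \<open>r\<close>, so the map is \<open>lmap k 0 s m\<close>.\<close>
proof (rule orbit_lmapI[of k m 0 s])
  show "k * m - 0 * s \<noteq> 0" using assms by simp
  fix x y :: "'a^2"
  show "lmap k 0 s m (tri (k * l) c' (k * a) (k * b) x y) =
      tri l c a b (lmap k 0 s m x) (lmap k 0 s m y)"
    using arg_cong[OF assms(3), of "\<lambda>z. z * (x$1 * y$1)"]
    by (simp add: tri_def mult_table_def vec_eq_iff forall_2 algebra_simps del: mult_cancel_right mult_cancel_left)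
qed

lemma orbit_tri_eq:
  assumes "k \<noteq> 0" "m \<noteq> 0" "m * c' = k * k * c + k * s * (a + b - l)"
    "l' = k * l" "a' = k * a" "b' = k * b"
  shows "orbit (tri l' c' a' b') = orbit (tri l c a b)"
  unfolding assms(4-) by (rule orbit_eq[OF orbit_triI[OF assms(1-3)]])

text \<open>A shear moves \<open>c\<close> by a multiple of a + b - l, so it clears \<open>c\<close>
  whenever this is nonzero. In the remaining case a nonzero \<open>c\<close> is rescaled to 1 by
  \<open>orbit_tri_scale_1\<close>.\<close>

lemma orbit_tri_linear_part:
  assumes "a + b \<noteq> l \<or> c = 0"
  shows "orbit (tri l 0 a b) = orbit (tri l c a b)"
proof (cases "c = 0")
  case False
  then show ?thesis
    using assms by (intro orbit_tri_eq[where k = 1 and m = 1 and s = "c / (l - (a + b))"])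
      (simp_all add: field_simps)
qed simp

lemma orbit_tri_scale:
  assumes "k \<noteq> 0" "a + b \<noteq> l \<or> c = 0" "l' = k * l" "a' = k * a" "b' = k * b"
  shows "orbit (tri l' 0 a' b') = orbit (tri l c a b)"
proof -
  have "orbit (tri l' 0 a' b') = orbit (tri l 0 a b)"
    by (rule orbit_tri_eq[where k = k and m = 1 and s = 0]) (use assms in simp_all)
  then show ?thesis using orbit_tri_linear_part[OF assms(2)] by simp
qed

lemma orbit_tri_scale_1:
  assumes "k \<noteq> 0" "c \<noteq> 0" "l' = k * l" "a' = k * a" "b' = k * b"
  shows "orbit (tri l' 1 a' b') = orbit (tri l c a b)"
  by (rule orbit_tri_eq[where k = k and m = "k * k * c" and s = 0]) (use assms in simp_all)

section \<open>The listed algebras as adapted tables\<close>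

lemma T01_tri: "T01 = tri 1 1 1 0"
  and T02_tri: "T02 = tri 1 1 2 (-1)"
  and T03_tri: "T03 = tri 0 1 0 0"
  and T06_tri: "T06 = tri 0 0 1 (-1)"
  and T07_tri: "T07 \<alpha> = tri 1 0 \<alpha> 0"
  and T08_tri: "T08 \<alpha> = tri 1 0 \<alpha> (3 - 2 * \<alpha>)"
  and zero_mult_tri: "zero_mult = tri 0 0 0 0"
  by (simp_all add: T01_def T02_def T03_def T06_def T07_def T08_def zero_mult_def tri_def
      mult_table_def fun_eq_iff)

lemma orbit_T04: "orbit T04 = orbit (tri 0 0 1 0)"
  by (intro orbit_eq orbit_lmapI[of 0 0 1 1])
     (auto simp: T04_def tri_def mult_table_def vec_eq_iff forall_2)

lemma orbit_T05: "orbit T05 = orbit (tri 0 0 (-1) 2)"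
  by (intro orbit_eq orbit_lmapI[of 0 0 1 1])
     (auto simp: T05_def tri_def mult_table_def vec_eq_iff forall_2)

text \<open>Here w = 0 and a + b = 1, so every vector with \<phi> = 1 is idempotent; the basis of
  \<open>T10\<close> consists of two of them, e1 and e1 + e2.\<close>

lemma orbit_T10: "orbit (T10 \<alpha>) = orbit (tri 1 0 \<alpha> (1 - \<alpha>))"
  by (intro orbit_eq orbit_lmapI[of 1 1 1 0])
     (auto simp: T10_def tri_def mult_table_def vec_eq_iff forall_2 algebra_simps)

subsection \<open>Zariski closures\<close>

lemma orbit_closure_eq:
  "orbit_closure X = T2 \<inter> zariski closure_of (T2 \<inter> (\<Union>\<mu>\<in>X. orbit \<mu>))"
  by (auto simp: orbit_closure_def closure_of_subtopology)

lemma orbit_closure_vanish: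
  assumes "p \<in> poly_funs" "\<And>\<mu> \<nu>. \<mu> \<in> X \<Longrightarrow> \<nu> \<in> orbit \<mu> \<Longrightarrow> p \<nu> = 0"
    and "\<nu> \<in> orbit_closure X"
  shows "p \<nu> = 0"
proof -
  have "closedin zariski (zero_locus {p})"
    using assms(1) by (auto simp: closedin_zariski intro!: exI[of _ "{p}"])
  moreover have "T2 \<inter> (\<Union>\<mu>\<in>X. orbit \<mu>) \<subseteq> zero_locus {p}"
    using assms(2) by (auto simp: zero_locus_def T2_def)
  ultimately have "zariski closure_of (T2 \<inter> (\<Union>\<mu>\<in>X. orbit \<mu>)) \<subseteq> zero_locus {p}"
    by (rule closure_of_minimal[rotated])
  then show ?thesis
    using assms(3) by (auto simp: orbit_closure_eq zero_locus_def)
qed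

lemma poly_funs_line:
  assumes "p \<in> poly_funs"
  shows "\<exists>P. \<forall>t. p (\<lambda>x y. m0 x y + t *s m1 x y) = poly P t"
  using assms
proof induction
  case (const c)
  show ?case by (intro exI[of _ "[:c:]"]) simp
next
  case (coord i j k)
  show ?case
    by (intro exI[of _ "[:m0 (axis i 1) (axis j 1) $ k, m1 (axis i 1) (axis j 1) $ k:]"]) simp
next
  case (add p q)
  then show ?case by (metis poly_add)
next
  case (mult p q)
  then show ?case by (metis poly_mult)
qed

text \<open>A polynomial restricted to the line has all \<open>t\<close> outside the finite set
  \<open>E\<close> as roots, hence is zero. So the point at t = 0 is a limit even if 0 lies in
  \<open>E\<close>.\<close>

lemma line_in_orbit_closure:
  fixes m0 m1 :: "'a::field_char_0 mult"
  assumes "m0 \<in> T2" "finite E"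
    and "\<And>t. t \<notin> E \<Longrightarrow> (\<lambda>x y. m0 x y + t *s m1 x y) \<in> T2 \<inter> (\<Union>\<mu>\<in>X. orbit \<mu>)"
  shows "m0 \<in> orbit_closure X"
proof -
  let ?S = "T2 \<inter> (\<Union>\<mu>\<in>X. orbit \<mu>)" and ?\<gamma> = "\<lambda>t x y. m0 x y + t *s m1 x y"
  obtain F where F: "F \<subseteq> poly_funs" "zariski closure_of ?S = zero_locus F"
    using closedin_closure_of[of zariski ?S] unfolding closedin_zariski by blast
  have S: "?S \<subseteq> zero_locus F"
    unfolding F(2)[symmetric] by (rule closure_of_subset) (auto simp: topspace_zariski T2_def)
  have "p m0 = 0" if "p \<in> F" for p
  proof -
    obtain P where P: "p (?\<gamma> t) = poly P t" for t
      using poly_funs_line[of p m0 m1] F(1) \<open>p \<in> F\<close> by blast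
    have "poly P t = 0" if "t \<notin> E" for t
      using assms(3)[OF that] S \<open>p \<in> F\<close> unfolding P[symmetric] by (auto simp: zero_locus_def)
    then have "- E \<subseteq> {t. poly P t = 0}" by auto
    then have "infinite {t. poly P t = 0}"
      using assms(2) infinite_UNIV_char_0[where 'a = 'a]
      by (metis finite_Un finite_subset Compl_partition)
    then have "P = 0" using poly_roots_finite by blast
    then show ?thesis using P[of 0] by simp
  qed
  then have "m0 \<in> zero_locus F" using assms(1) by (auto simp: zero_locus_def T2_def)
  then show ?thesis using assms(1) F(2) by (simp add: orbit_closure_eq)
qed

text \<open>The line moves \<open>l\<close> by t and \<open>b\<close> by t d; the slope
  \<open>d\<close> is chosen per family to stay in its linear space. As \<open>act g\<close> is
  linear in the multiplication, the line can be transported to any point of the orbit.\<close>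

lemma orbit_tri_in_closure:
  fixes l c a b d :: "'a::field_char_0"
  assumes "finite E" and T2: "\<And>t. b + t * d = 0 \<or> b + t * d = 3 * (l + t) - 2 * a \<or>
      l + t = a + (b + t * d) \<and> c = 0"
    and X: "\<And>t. t \<notin> E \<Longrightarrow> \<exists>\<tau>\<in>X. tri (l + t) c a (b + t * d) \<in> orbit \<tau>"
  shows "orbit (tri l c a b) \<subseteq> orbit_closure X"
proof
  fix \<nu> assume \<nu>: "\<nu> \<in> orbit (tri l c a b)"
  then obtain g where g: "g \<in> GLV" "\<nu> = act g (tri l c a b)" by (auto simp: orbit_def)
  have tri_line: "tri (l + t) c a (b + t * d) x y = tri l c a b x y + t *s tri 1 0 0 d x y" for t x y
    by (simp add: tri_def mult_table_def vec_eq_iff forall_2 algebra_simps)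
  have line: "(\<lambda>x y. \<nu> x y + t *s act g (tri 1 0 0 d) x y) = act g (tri (l + t) c a (b + t * d))" for t
    unfolding g(2) act_def tri_line GLV_linear[OF g(1)] by simp
  show "\<nu> \<in> orbit_closure X"
  proof (rule line_in_orbit_closure[OF _ \<open>finite E\<close>])
    show "\<nu> \<in> T2" using orbit_tri_T2[OF \<nu>] T2[of 0] by simp
    fix t assume "t \<notin> E"
    then obtain \<tau> where \<tau>: "\<tau> \<in> X" "tri (l + t) c a (b + t * d) \<in> orbit \<tau>" using X by blast
    have act: "act g (tri (l + t) c a (b + t * d)) \<in> orbit (tri (l + t) c a (b + t * d))"
      using g(1) unfolding orbit_def by blast
    then show "(\<lambda>x y. \<nu> x y + t *s act g (tri 1 0 0 d) x y) \<in> T2 \<inter> (\<Union>\<mu>\<in>X. orbit \<mu>)"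
      using orbit_tri_T2[OF act T2] \<tau> orbit_trans unfolding line by blast
  qed
qed

lemma poly_funs_diff: "p \<in> poly_funs \<Longrightarrow> q \<in> poly_funs \<Longrightarrow> (\<lambda>\<mu>. p \<mu> - q \<mu>) \<in> poly_funs"
  using poly_funs.add[OF _ poly_funs.mult[OF poly_funs.const[of "-1"]]] by force

subsection \<open>Change of basis for structure constants\<close>

definition sc :: "2 \<Rightarrow> 2 \<Rightarrow> 2 \<Rightarrow> 'a::field mult \<Rightarrow> 'a" where
  "sc i j k \<mu> = \<mu> (axis i 1) (axis j 1) $ k"

lemma sc_poly_funs: "sc i j k \<in> poly_funs"
  unfolding sc_def by (rule poly_funs.coord)

lemmas poly_funs_intros =
  sc_poly_funs poly_funs.const poly_funs.add poly_funs.mult poly_funs_diff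

lemma A2_linear:
  assumes "\<mu> \<in> A2"
  shows "\<mu> (x + x') y = \<mu> x y + \<mu> x' y" "\<mu> x (y + y') = \<mu> x y + \<mu> x y'"
    "\<mu> (c *s x) y = c *s \<mu> x y" "\<mu> x (c *s y) = c *s \<mu> x y"
  using assms by (auto simp: A2_def linear_iff_vec)

lemma A2_expand:
  assumes "\<mu> \<in> A2"
  shows "\<mu> = mult_table (\<mu> e1 e1) (\<mu> e1 e2) (\<mu> e2 e1) (\<mu> e2 e2)"
proof (intro ext)
  fix x y
  have e: "z = z$1 *s e1 + z$2 *s e2" for z :: "'a^2"
    by (simp add: vec_eq_iff forall_2)
  have "\<mu> x y = \<mu> (x$1 *s e1 + x$2 *s e2) (y$1 *s e1 + y$2 *s e2)"
    using e[of x] e[of y] by simp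
  also have "\<dots> = mult_table (\<mu> e1 e1) (\<mu> e1 e2) (\<mu> e2 e1) (\<mu> e2 e2) x y"
    by (simp add: A2_linear[OF assms] mult_table_def) (simp add: vec_eq_iff algebra_simps)
  finally show "\<mu> x y = mult_table (\<mu> e1 e1) (\<mu> e1 e2) (\<mu> e2 e1) (\<mu> e2 e2) x y" .
qed

lemma A2_eq_triI:
  assumes "\<mu> \<in> A2" "sc 1 2 1 \<mu> = 0" "sc 2 1 1 \<mu> = 0" "sc 2 2 1 \<mu> = 0" "sc 2 2 2 \<mu> = 0"
  shows "\<mu> = tri (sc 1 1 1 \<mu>) (sc 1 1 2 \<mu>) (sc 1 2 2 \<mu>) (sc 2 1 2 \<mu>)"
proof -
  have "\<mu> e1 e1 = sc 1 1 1 \<mu> *s e1 + sc 1 1 2 \<mu> *s e2" "\<mu> e1 e2 = sc 1 2 2 \<mu> *s e2"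
    "\<mu> e2 e1 = sc 2 1 2 \<mu> *s e2" "\<mu> e2 e2 = 0"
    using assms(2-) by (simp_all add: sc_def vec_eq_iff forall_2)
  then show ?thesis using A2_expand[OF assms(1)] unfolding tri_def by metis
qed

lemma orbit_change_basis:
  assumes "\<And>x. g (h x) = x" "\<And>x. h (g x) = x" "h = lmap p q r s" "p * s - q * r \<noteq> 0"
  shows "(\<lambda>x y. g (\<mu> (h x) (h y))) \<in> orbit \<mu>"
  using assms by (intro orbit_lmapI[of p s q r]) auto

lemma orbit_swap:
  assumes "\<mu> \<in> A2"
  obtains \<nu> where "\<nu> \<in> orbit \<mu>"
    "sc 1 1 1 \<nu> = sc 2 2 2 \<mu>" "sc 1 1 2 \<nu> = sc 2 2 1 \<mu>"
    "sc 1 2 1 \<nu> = sc 2 1 2 \<mu>" "sc 1 2 2 \<nu> = sc 2 1 1 \<mu>"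
    "sc 2 1 1 \<nu> = sc 1 2 2 \<mu>" "sc 2 1 2 \<nu> = sc 1 2 1 \<mu>"
    "sc 2 2 1 \<nu> = sc 1 1 2 \<mu>" "sc 2 2 2 \<nu> = sc 1 1 1 \<mu>"
proof -
  let ?g = "lmap 0 1 1 0 :: 'a^2 \<Rightarrow> 'a^2"
  have g: "?g (axis 1 1) = axis 2 1" "?g (axis 2 1) = axis 1 1"
    by (simp_all add: vec_eq_iff forall_2)
  have "(\<lambda>x y. ?g (\<mu> (?g x) (?g y))) \<in> orbit \<mu>"
    by (rule orbit_change_basis[OF _ _ refl]) (simp_all add: vec_eq_iff forall_2)
  then show thesis by (rule that) (simp_all add: sc_def g)
qed

text \<open>Structure constants in the basis e1, e2 + t e1. Later \<open>t\<close> is chosen to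
  bring the second basis vector into the kernel of \<phi>.\<close>

lemma orbit_shear:
  fixes \<mu> :: "'a::field mult" and t :: 'a
  assumes "\<mu> \<in> A2"
  obtains \<nu> where "\<nu> \<in> orbit \<mu>"
    "sc 1 1 1 \<nu> = sc 1 1 1 \<mu> - t * sc 1 1 2 \<mu>" "sc 1 1 2 \<nu> = sc 1 1 2 \<mu>"
    "sc 1 2 1 \<nu> = sc 1 2 1 \<mu> + t * sc 1 1 1 \<mu> - t * (sc 1 2 2 \<mu> + t * sc 1 1 2 \<mu>)"
    "sc 1 2 2 \<nu> = sc 1 2 2 \<mu> + t * sc 1 1 2 \<mu>"
    "sc 2 1 1 \<nu> = sc 2 1 1 \<mu> + t * sc 1 1 1 \<mu> - t * (sc 2 1 2 \<mu> + t * sc 1 1 2 \<mu>)"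
    "sc 2 1 2 \<nu> = sc 2 1 2 \<mu> + t * sc 1 1 2 \<mu>"
    "sc 2 2 1 \<nu> = sc 2 2 1 \<mu> + t * sc 1 2 1 \<mu> + t * (sc 2 1 1 \<mu> + t * sc 1 1 1 \<mu>)
       - t * (sc 2 2 2 \<mu> + t * sc 1 2 2 \<mu> + t * (sc 2 1 2 \<mu> + t * sc 1 1 2 \<mu>))"
    "sc 2 2 2 \<nu> = sc 2 2 2 \<mu> + t * sc 1 2 2 \<mu> + t * (sc 2 1 2 \<mu> + t * sc 1 1 2 \<mu>)"
proof -
  let ?g = "lmap 1 (-t) 0 1" and ?h = "lmap 1 t 0 1"
  have h: "?h (axis 1 1) = axis 1 1" "?h (axis 2 1) = axis 2 1 + t *s axis 1 1"
    by (simp_all add: vec_eq_iff forall_2)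
  have "(\<lambda>x y. ?g (\<mu> (?h x) (?h y))) \<in> orbit \<mu>"
    by (rule orbit_change_basis[OF _ _ refl]) (simp_all add: vec_eq_iff forall_2)
  then show thesis by (rule that) (simp_all add: sc_def h A2_linear[OF assms] algebra_simps)
qed

lemma sc_form:
  "sc i j k (form u w a b) =
     a * u$i * (if j = k then 1 else 0) + b * u$j * (if i = k then 1 else 0) + u$i * u$j * w$k"
proof -
  have "lin u (axis m 1) = u$m" for m
    using exhaust_2[of m] by (auto simp: lin_def)
  then show ?thesis by (simp add: sc_def form_def axis_def)
qed

subsection \<open>The family T07\<close>

text \<open>For b = 0 the product is \<phi>(x) T(y) with T(y) = a y + \<phi>(y) w. All left
  multiplications are thus proportional, and these are the minors of the matrix with rows the left
  multiplications by e1 and e2.\<close>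

lemma T07_closure_minors:
  assumes "\<nu> \<in> orbit_closure T07_family"
  shows "sc 1 j k \<nu> * sc 2 m n \<nu> - sc 2 j k \<nu> * sc 1 m n \<nu> = 0"
proof (rule orbit_closure_vanish[OF _ _ assms])
  show "(\<lambda>\<nu>. sc 1 j k \<nu> * sc 2 m n \<nu> - sc 2 j k \<nu> * sc 1 m n \<nu>) \<in> poly_funs"
    by (intro poly_funs_intros)
  fix \<tau> \<rho> :: "'a mult" assume "\<tau> \<in> T07_family" "\<rho> \<in> orbit \<tau>"
  then obtain u w a where "\<rho> = form u w a 0"
    using orbit_tri_form unfolding T07_family_def T07_tri by blast
  then show "sc 1 j k \<rho> * sc 2 m n \<rho> - sc 2 j k \<rho> * sc 1 m n \<rho> = 0"
    by (simp add: sc_form algebra_simps)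
qed

text \<open>The bracketed sums are \<phi>(T(e2)) and \<phi>(T(e1)). The equation says that \<phi>
  composed with T is proportional to \<phi>.\<close>

lemma T07_closure_eigen:
  assumes "\<nu> \<in> orbit_closure T07_family"
  shows "sc 1 j k \<nu> * (sc 1 2 1 \<nu> + sc 2 2 2 \<nu>) - sc 2 j k \<nu> * (sc 1 1 1 \<nu> + sc 2 1 2 \<nu>) = 0"
proof (rule orbit_closure_vanish[OF _ _ assms])
  show "(\<lambda>\<nu>. sc 1 j k \<nu> * (sc 1 2 1 \<nu> + sc 2 2 2 \<nu>) -
      sc 2 j k \<nu> * (sc 1 1 1 \<nu> + sc 2 1 2 \<nu>)) \<in> poly_funs"
    by (intro poly_funs_intros)
  fix \<tau> \<rho> :: "'a mult" assume "\<tau> \<in> T07_family" "\<rho> \<in> orbit \<tau>"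
  then obtain u w a where "\<rho> = form u w a 0"
    using orbit_tri_form unfolding T07_family_def T07_tri by blast
  then show "sc 1 j k \<rho> * (sc 1 2 1 \<rho> + sc 2 2 2 \<rho>) -
      sc 2 j k \<rho> * (sc 1 1 1 \<rho> + sc 2 1 2 \<rho>) = 0"
    by (simp add: sc_form algebra_simps)
qed

lemma orbit_closure_A2: "orbit_closure X \<subseteq> A2"
  by (auto simp: orbit_closure_eq T2_def)

lemma T07_closure_tri:
  assumes "orbit \<mu> \<subseteq> orbit_closure T07_family"
  shows "\<exists>l c a. tri l c a 0 \<in> orbit \<mu>"
proof -
  have A2: "\<nu> \<in> A2" if "\<nu> \<in> orbit \<mu>" for \<nu>
    using assms that orbit_closure_A2 by blast
  show ?thesis
  proof (cases "\<forall>\<nu>\<in>orbit \<mu>. \<forall>j k. sc 1 j k \<nu> = 0")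
    case True
    obtain \<nu> where \<nu>: "\<nu> \<in> orbit \<mu>" "sc 2 1 1 \<nu> = sc 1 2 2 \<mu>" "sc 2 1 2 \<nu> = sc 1 2 1 \<mu>"
      "sc 2 2 1 \<nu> = sc 1 1 2 \<mu>" "sc 2 2 2 \<nu> = sc 1 1 1 \<mu>"
      using orbit_swap[OF A2[OF orbit_refl]] by metis
    have "\<nu> = tri 0 0 0 0"
      using A2_eq_triI[OF A2[OF \<nu>(1)]] True \<nu> by simp
    then show ?thesis using \<nu>(1) by blast
  next
    case False
    then obtain \<rho> j k where \<rho>: "\<rho> \<in> orbit \<mu>" "sc 1 j k \<rho> \<noteq> 0" by blast
    \<comment> \<open>This \<open>t\<close> makes left multiplication by e2 + t e1 zero; the minors
      extend the choice from one entry to all.\<close>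
    define t where "t = - sc 2 j k \<rho> / sc 1 j k \<rho>"
    have t: "sc 2 m n \<rho> + t * sc 1 m n \<rho> = 0" for m n
      using T07_closure_minors[of \<rho> j k m n] \<rho> assms by (auto simp: t_def field_simps)
    obtain \<nu> where \<nu>: "\<nu> \<in> orbit \<rho>"
      "sc 2 1 1 \<nu> = sc 2 1 1 \<rho> + t * sc 1 1 1 \<rho> - t * (sc 2 1 2 \<rho> + t * sc 1 1 2 \<rho>)"
      "sc 2 1 2 \<nu> = sc 2 1 2 \<rho> + t * sc 1 1 2 \<rho>"
      "sc 2 2 1 \<nu> = sc 2 2 1 \<rho> + t * sc 1 2 1 \<rho> + t * (sc 2 1 1 \<rho> + t * sc 1 1 1 \<rho>)
        - t * (sc 2 2 2 \<rho> + t * sc 1 2 2 \<rho> + t * (sc 2 1 2 \<rho> + t * sc 1 1 2 \<rho>))"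
      "sc 2 2 2 \<nu> = sc 2 2 2 \<rho> + t * sc 1 2 2 \<rho> + t * (sc 2 1 2 \<rho> + t * sc 1 1 2 \<rho>)"
      using orbit_shear[OF A2[OF \<rho>(1)], of t] by metis
    have 2: "sc 2 1 1 \<nu> = 0" "sc 2 1 2 \<nu> = 0" "sc 2 2 1 \<nu> = 0" "sc 2 2 2 \<nu> = 0"
      unfolding \<nu>(2-) t by simp_all
    have \<nu>\<mu>: "\<nu> \<in> orbit \<mu>" using \<nu>(1) \<rho>(1) orbit_trans by blast
    \<comment> \<open>For j = 2, k = 1 the equation reduces to the square of this constant.\<close>
    then have "sc 1 2 1 \<nu> = 0"
      using T07_closure_eigen[of \<nu> 2 1] assms 2 by auto
    then have "\<nu> = tri (sc 1 1 1 \<nu>) (sc 1 1 2 \<nu>) (sc 1 2 2 \<nu>) 0"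
      using A2_eq_triI[OF A2[OF \<nu>\<mu>]] 2 by simp
    then show ?thesis using \<nu>\<mu> by metis
  qed
qed

lemma tri_in_T07_closure:
  "orbit (tri l c a (0::'a::field_char_0)) \<subseteq> orbit_closure T07_family"
\<comment> \<open>Excluded are l + t = 0, where \<open>l\<close> cannot be scaled to 1, and a = l +
  t, which would give the parameter 1.\<close>
proof (rule orbit_tri_in_closure[where d = 0 and E = "{- l, a - l}"])
  fix t assume "t \<notin> {- l, a - l}"
  then have t: "l + t \<noteq> 0" "a \<noteq> l + t"
    by (auto simp: add_eq_0_iff algebra_simps)
  have "orbit (tri 1 0 (a / (l + t)) 0) = orbit (tri (l + t) c a 0)"
    by (rule orbit_tri_scale[where k = "1 / (l + t)"]) (use t in simp_all)
  then have "tri (l + t) c a 0 \<in> orbit (T07 (a / (l + t)))"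
    unfolding T07_tri by simp
  moreover have "T07 (a / (l + t)) \<in> T07_family"
    using t by (auto simp: T07_family_def)
  ultimately show "\<exists>\<tau>\<in>T07_family. tri (l + t) c a (0 + t * 0) \<in> orbit \<tau>" by auto
qed auto

lemma T07_closure_iff:
  "orbit \<mu> \<subseteq> orbit_closure T07_family \<longleftrightarrow>
     (\<exists>l c a. orbit (tri l c a (0::'a::field_char_0)) = orbit \<mu>)"
  using T07_closure_tri tri_in_T07_closure orbit_eq by metis

subsection \<open>The family T10\<close>

lemma T10_family_form:
  assumes "\<tau> \<in> T10_family" "\<rho> \<in> orbit \<tau>"
  shows "\<exists>u a b. \<rho> = form u 0 a b"
proof -
  obtain \<alpha> where "\<rho> \<in> orbit (tri 1 0 \<alpha> (1 - \<alpha>))"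
    using assms by (auto simp: T10_family_def orbit_T10)
  from orbit_tri_form[OF this] show ?thesis by auto
qed

text \<open>The first four equations say that \<mu>(x,x) is always proportional to x. The last says
  that the linear forms a \<phi> and b \<phi>, read off from the mixed products, are
  proportional.\<close>

lemma T10_closure_eqs:
  assumes "\<nu> \<in> orbit_closure T10_family"
  shows "sc 1 1 2 \<nu> = 0" "sc 2 2 1 \<nu> = 0"
    "sc 1 1 1 \<nu> - (sc 1 2 2 \<nu> + sc 2 1 2 \<nu>) = 0"
    "sc 2 2 2 \<nu> - (sc 1 2 1 \<nu> + sc 2 1 1 \<nu>) = 0"
    "sc 1 2 2 \<nu> * sc 1 2 1 \<nu> - sc 2 1 1 \<nu> * sc 2 1 2 \<nu> = 0"
  by (rule orbit_closure_vanish[OF _ _ assms];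
      force intro: poly_funs_intros dest: T10_family_form simp: sc_form algebra_simps)+

lemma T10_closure_tri:
  assumes "orbit \<mu> \<subseteq> orbit_closure T10_family"
  shows "\<exists>a b. tri (a + b) 0 a b \<in> orbit \<mu>"
proof -
  have A2: "\<nu> \<in> A2" if "\<nu> \<in> orbit \<mu>" for \<nu>
    using assms that orbit_closure_A2 by blast
  have *: ?thesis if "\<nu> \<in> orbit \<mu>" "sc 1 2 1 \<nu> = 0" "sc 2 1 1 \<nu> = 0" for \<nu>
  proof -
    note E = T10_closure_eqs[OF subsetD[OF assms that(1)]]
    have "\<nu> = tri (sc 1 1 1 \<nu>) (sc 1 1 2 \<nu>) (sc 1 2 2 \<nu>) (sc 2 1 2 \<nu>)"
      using E that by (intro A2_eq_triI A2) auto
    then show ?thesis using that(1) E(1,3) by (metis eq_iff_diff_eq_0)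
  qed
  note E = T10_closure_eqs[OF subsetD[OF assms orbit_refl]]
  show ?thesis
  proof (cases "sc 1 2 2 \<mu> = 0 \<and> sc 2 1 2 \<mu> = 0")
    case True
    then show ?thesis
      using orbit_swap[OF A2[OF orbit_refl]] * by metis
  next
    case False
    \<comment> \<open>The nonzero one of the two proportional forms determines \<open>t\<close>;
      proportionality makes the other vanish on e2 + t e1 as well.\<close>
    define t where "t = (if sc 1 2 2 \<mu> = 0 then - sc 1 2 1 \<mu> / sc 2 1 2 \<mu>
      else - sc 2 1 1 \<mu> / sc 1 2 2 \<mu>)"
    have t: "sc 1 2 1 \<mu> + t * sc 2 1 2 \<mu> = 0" "sc 2 1 1 \<mu> + t * sc 1 2 2 \<mu> = 0"
      using False E(5) by (auto simp: t_def field_simps)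
    obtain \<nu> where \<nu>: "\<nu> \<in> orbit \<mu>"
      "sc 1 2 1 \<nu> = sc 1 2 1 \<mu> + t * sc 1 1 1 \<mu> - t * (sc 1 2 2 \<mu> + t * sc 1 1 2 \<mu>)"
      "sc 2 1 1 \<nu> = sc 2 1 1 \<mu> + t * sc 1 1 1 \<mu> - t * (sc 2 1 2 \<mu> + t * sc 1 1 2 \<mu>)"
      using orbit_shear[OF A2[OF orbit_refl], of t] by metis
    have "sc 1 2 1 \<nu> = 0" "sc 2 1 1 \<nu> = 0"
      using E(1,3) t unfolding \<nu>(2-) by (simp_all add: algebra_simps)
    then show ?thesis using * \<nu>(1) by blast
  qed
qed

lemma tri_in_T10_closure:
  "orbit (tri (a + b) 0 a (b::'a::field_char_0)) \<subseteq> orbit_closure T10_family"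
proof (rule orbit_tri_in_closure[where d = 1 and E = "{- (a + b)}"])
  fix t assume "t \<notin> {- (a + b)}"
  then have t: "a + b + t \<noteq> 0"
    by (metis add_eq_0_iff singletonI)
  have "orbit (tri 1 0 (a / (a + b + t)) (1 - a / (a + b + t))) = orbit (tri (a + b + t) 0 a (b + t))"
    by (rule orbit_tri_scale[where k = "1 / (a + b + t)"]) (use t in \<open>simp_all add: field_simps\<close>)
  then have "tri (a + b + t) 0 a (b + t) \<in> orbit (T10 (a / (a + b + t)))"
    unfolding orbit_T10 by simp
  then show "\<exists>\<tau>\<in>T10_family. tri (a + b + t) 0 a (b + t * 1) \<in> orbit \<tau>"
    by (auto simp: T10_family_def)
qed auto

lemma T10_closure_iff:
  "orbit \<mu> \<subseteq> orbit_closure T10_family \<longleftrightarrow>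
     (\<exists>a b. orbit (tri (a + b) 0 a (b::'a::field_char_0)) = orbit \<mu>)"
  using T10_closure_tri tri_in_T10_closure orbit_eq by metis


subsection \<open>The family T08\<close>

text \<open>The traces of left and right multiplication by a basis vector: two linear forms attached
  covariantly to the multiplication.\<close>

definition trL :: "2 \<Rightarrow> 'a::field mult \<Rightarrow> 'a" where
  "trL i \<mu> = sc i 1 1 \<mu> + sc i 2 2 \<mu>"

definition trR :: "2 \<Rightarrow> 'a::field mult \<Rightarrow> 'a" where
  "trR i \<mu> = sc 1 i 1 \<mu> + sc 2 i 2 \<mu>"

text \<open>The coefficients of the binary cubic form \<open>f(x) = det(\<mu>(x,x), x)\<close>, which for a
  multiplication \<^const>\<open>form\<close> equals \<open>\<phi>(x)\<^sup>2 det(w, x)\<close>.\<close>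

definition cubA :: "'a::field mult \<Rightarrow> 'a" where
  "cubA \<mu> = - sc 1 1 2 \<mu>"
definition cubB :: "'a::field mult \<Rightarrow> 'a" where
  "cubB \<mu> = sc 1 1 1 \<mu> - sc 1 2 2 \<mu> - sc 2 1 2 \<mu>"
definition cubC :: "'a::field mult \<Rightarrow> 'a" where
  "cubC \<mu> = sc 1 2 1 \<mu> + sc 2 1 1 \<mu> - sc 2 2 2 \<mu>"
definition cubD :: "'a::field mult \<Rightarrow> 'a" where
  "cubD \<mu> = sc 2 2 1 \<mu>"

lemma trace_cubic_poly_funs:
  "trL i \<in> poly_funs" "trR i \<in> poly_funs"
  "cubA \<in> poly_funs" "cubB \<in> poly_funs" "cubC \<in> poly_funs" "cubD \<in> poly_funs"
proof -
  have "(\<lambda>\<mu>. 0 - sc 1 1 2 \<mu>) \<in> poly_funs"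
    by (intro poly_funs_intros)
  then show "cubA \<in> poly_funs" by (simp add: cubA_def[abs_def])
qed (unfold trL_def[abs_def] trR_def[abs_def] cubB_def[abs_def] cubC_def[abs_def] cubD_def[abs_def];
    intro poly_funs_intros)+

text \<open>The relation a + 2 b + 3 \<phi>(w) = 0 eliminates \<open>a\<close>, so that the closure
  equations become polynomial identities in free \<open>u\<close>, \<open>w\<close>,
  \<open>b\<close>.\<close>

lemma T08_family_form:
  assumes "\<tau> \<in> T08_family" "\<rho> \<in> orbit \<tau>"
  shows "\<exists>u w b. \<rho> = form u w (- 2 * b - 3 * lin u w) b"
proof -
  obtain \<alpha> where "\<tau> = tri 1 0 \<alpha> (3 - 2 * \<alpha>)"
    using assms(1) by (auto simp: T08_family_def T08_tri)
  then obtain u w where "\<rho> = form u w \<alpha> (3 - 2 * \<alpha>)" "lin u w = 1 - \<alpha> - (3 - 2 * \<alpha>)"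
    using orbit_tri_form assms(2) by blast
  moreover from this(2) have "- 2 * (3 - 2 * \<alpha>) - 3 * lin u w = \<alpha>"
    by (simp only:) (simp add: algebra_simps)
  ultimately have "\<rho> = form u w (- 2 * (3 - 2 * \<alpha>) - 3 * lin u w) (3 - 2 * \<alpha>)"
    by simp
  then show ?thesis by blast
qed

text \<open>In general the traces are (2 a + b + \<phi>(w)) \<phi> and (a + 2 b + \<phi>(w)) \<phi>;
  the relation for \<open>a\<close> removes \<open>b\<close> from the second.\<close>

lemma trace_cubic_form:
  fixes u w :: "'a::field^2"
  assumes "\<rho> = form u w (- 2 * b - 3 * lin u w) b"
  shows "trL i \<rho> = (- 3 * b - 5 * lin u w) * u$i" "trR i \<rho> = - 2 * lin u w * u$i"
    "cubA \<rho> = - (u$1 * u$1 * w$2)" "cubB \<rho> = u$1 * (u$1 * w$1 - 2 * (u$2 * w$2))"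
    "cubC \<rho> = u$2 * (2 * (u$1 * w$1) - u$2 * w$2)" "cubD \<rho> = u$2 * u$2 * w$1"
proof -
  have "i = 1 \<or> i = 2" using exhaust_2 by blast
  then show "trL i \<rho> = (- 3 * b - 5 * lin u w) * u$i" "trR i \<rho> = - 2 * lin u w * u$i"
    unfolding assms trL_def trR_def sc_form
    by (auto simp: lin_def algebra_simps)
qed (simp_all add: assms cubA_def cubB_def cubC_def cubD_def sc_form algebra_simps)

lemma trace_cubic_identities:
  fixes u1 u2 w1 w2 b s l1 l2 r1 r2 A B C D :: "'a::field"
  assumes "s = u1 * w1 + u2 * w2"
    and "l1 = (- 3 * b - 5 * s) * u1" "l2 = (- 3 * b - 5 * s) * u2"
    and "r1 = - 2 * s * u1" "r2 = - 2 * s * u2"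
    and "A = - (u1 * u1 * w2)" "B = u1 * (u1 * w1 - 2 * (u2 * w2))"
    and "C = u2 * (2 * (u1 * w1) - u2 * w2)" "D = u2 * u2 * w1"
  shows "r1 * r1 - 4 * (B * B - 3 * (A * C)) = 0"
    "r1 * r2 - 2 * (B * C - 9 * (A * D)) = 0"
    "r2 * r2 - 4 * (C * C - 3 * (B * D)) = 0"
    "2 * (r1 * B) - 6 * (r2 * A) + r1 * r1 = 0"
    "2 * (r1 * C) - 2 * (r2 * B) + r1 * r2 = 0"
    "6 * (r1 * D) - 2 * (r2 * C) + r2 * r2 = 0"
    "2 * (l1 * B) - 6 * (l2 * A) + l1 * r1 = 0"
    "l1 * r2 - l2 * r1 = 0"
  unfolding assms by algebra+

text \<open>On the orbits of the family both traces are multiples of \<open>\<phi>\<close>, with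
  \<open>trR = - 2 \<phi>(w) \<phi>\<close>, while the Hessian of \<open>f\<close> is proportional to \<open>\<phi>(w)\<^sup>2 \<phi>\<^sup>2\<close>.
  The first three equations identify \<open>trR\<^sup>2\<close> with the Hessian, the next three identify it with the
  Jacobian of \<open>trR\<close> and \<open>f\<close>, which fixes the sign of \<open>trR\<close>; the seventh is one coefficient of
  the Jacobian of \<open>trL\<close> and \<open>f\<close>.\<close>

lemma T08_closure_eqs:
  assumes "\<nu> \<in> orbit_closure T08_family"
  shows "trR 1 \<nu> * trR 1 \<nu> - 4 * (cubB \<nu> * cubB \<nu> - 3 * (cubA \<nu> * cubC \<nu>)) = 0"
    "trR 1 \<nu> * trR 2 \<nu> - 2 * (cubB \<nu> * cubC \<nu> - 9 * (cubA \<nu> * cubD \<nu>)) = 0"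
    "trR 2 \<nu> * trR 2 \<nu> - 4 * (cubC \<nu> * cubC \<nu> - 3 * (cubB \<nu> * cubD \<nu>)) = 0"
    "2 * (trR 1 \<nu> * cubB \<nu>) - 6 * (trR 2 \<nu> * cubA \<nu>) + trR 1 \<nu> * trR 1 \<nu> = 0"
    "2 * (trR 1 \<nu> * cubC \<nu>) - 2 * (trR 2 \<nu> * cubB \<nu>) + trR 1 \<nu> * trR 2 \<nu> = 0"
    "6 * (trR 1 \<nu> * cubD \<nu>) - 2 * (trR 2 \<nu> * cubC \<nu>) + trR 2 \<nu> * trR 2 \<nu> = 0"
    "2 * (trL 1 \<nu> * cubB \<nu>) - 6 * (trL 2 \<nu> * cubA \<nu>) + trL 1 \<nu> * trR 1 \<nu> = 0"
    "trL 1 \<nu> * trR 2 \<nu> - trL 2 \<nu> * trR 1 \<nu> = 0"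
  by (rule orbit_closure_vanish[OF _ _ assms],
      (intro poly_funs_intros trace_cubic_poly_funs)[1],
      drule (1) T08_family_form, elim exE,
      (rule trace_cubic_identities[OF lin_def trace_cubic_form(1) trace_cubic_form(1) trace_cubic_form(2) trace_cubic_form(2)
        trace_cubic_form(3) trace_cubic_form(4) trace_cubic_form(5) trace_cubic_form(6)]; assumption))+

text \<open>The swap has determinant -1, whence the signs in the cubic form.\<close>

lemma orbit_swap_trace_cubic:
  assumes "\<mu> \<in> A2"
  obtains \<nu> where "\<nu> \<in> orbit \<mu>" "trL 1 \<nu> = trL 2 \<mu>" "trL 2 \<nu> = trL 1 \<mu>"
    "trR 1 \<nu> = trR 2 \<mu>" "trR 2 \<nu> = trR 1 \<mu>"
    "cubA \<nu> = - cubD \<mu>" "cubD \<nu> = - cubA \<mu>"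
  by (rule orbit_swap[OF assms], rule that, assumption)
     (simp_all add: trL_def trR_def cubA_def cubD_def algebra_simps)

text \<open>The shear has determinant 1, so the new \<open>cubD\<close> is the value of the old
  cubic form at e2 + t e1.\<close>

lemma orbit_shear_trace_cubic:
  fixes \<mu> :: "'a::field mult" and t :: 'a
  assumes "\<mu> \<in> A2"
  obtains \<nu> where "\<nu> \<in> orbit \<mu>" "trL 2 \<nu> = trL 2 \<mu> + t * trL 1 \<mu>"
    "trR 1 \<nu> = trR 1 \<mu>" "trR 2 \<nu> = trR 2 \<mu> + t * trR 1 \<mu>" "cubA \<nu> = cubA \<mu>"
    "cubD \<nu> = cubD \<mu> + t * cubC \<mu> + t * t * cubB \<mu> + t * t * t * cubA \<mu>"
  by (rule orbit_shear[OF assms, of t], rule that, assumption)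
     (simp_all add: trL_def trR_def cubA_def cubB_def cubC_def cubD_def algebra_simps)

text \<open>The vanishing of both traces at e2 and of \<open>cubC\<close> gives 3
  \<open>sc 2 2 2\<close> = 0, hence the triangular shape. The condition on \<open>trR 1\<close> is
  then the linear relation b = 3 l - 2 a.\<close>

lemma trace_cubic_eq_tri:
  fixes \<nu> :: "'a::field_char_0 mult"
  assumes "\<nu> \<in> A2" "trL 2 \<nu> = 0" "trR 2 \<nu> = 0" "cubC \<nu> = 0" "cubD \<nu> = 0"
    "trR 1 \<nu> = - 2 * cubB \<nu>"
  shows "\<exists>l c a. \<nu> = tri l c a (3 * l - 2 * a)"
proof -
  have 1: "sc 2 2 1 \<nu> = 0" "sc 1 2 1 \<nu> = - sc 2 2 2 \<nu>" "sc 2 1 1 \<nu> = - sc 2 2 2 \<nu>"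
    "sc 1 2 1 \<nu> + sc 2 1 1 \<nu> - sc 2 2 2 \<nu> = 0"
    using assms(2-5) by (auto simp: trL_def trR_def cubC_def cubD_def add_eq_0_iff2)
  then have "3 * sc 2 2 2 \<nu> = 0" unfolding 1(2,3) by (simp add: algebra_simps)
  then have 0: "sc 2 2 2 \<nu> = 0" by simp
  have "sc 2 1 2 \<nu> = 3 * sc 1 1 1 \<nu> - 2 * sc 1 2 2 \<nu>"
    using assms(6) by (simp add: trR_def cubB_def algebra_simps)
  then show ?thesis
    using A2_eq_triI[OF assms(1)] 0 1 by (metis minus_zero)
qed

lemma T08_closure_tri:
  fixes \<mu> :: "'a::field_char_0 mult"
  assumes "orbit \<mu> \<subseteq> orbit_closure T08_family"
  shows "\<exists>l c a. tri l c a (3 * l - 2 * a) \<in> orbit \<mu>"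
proof -
  have A2: "\<nu> \<in> A2" if "\<nu> \<in> orbit \<mu>" for \<nu>
    using assms that orbit_closure_A2 by blast
  have E: "\<nu> \<in> orbit_closure T08_family" if "\<nu> \<in> orbit \<mu>" for \<nu>
    using assms that by blast
  have "\<exists>\<nu>\<in>orbit \<mu>. trL 2 \<nu> = 0 \<and> trR 2 \<nu> = 0 \<and> cubC \<nu> = 0 \<and> cubD \<nu> = 0 \<and>
      trR 1 \<nu> = - 2 * cubB \<nu>"
  proof -
    \<comment> \<open>The kernel of \<phi> is recovered from the first nonzero object among
      \<open>trR\<close>, the cubic form and \<open>trL\<close>.\<close>
    consider (R) "\<exists>\<nu>\<in>orbit \<mu>. trR 1 \<nu> \<noteq> 0"
      | (cub) "\<forall>\<nu>\<in>orbit \<mu>. trR 1 \<nu> = 0" "\<exists>\<nu>\<in>orbit \<mu>. cubA \<nu> \<noteq> 0"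
      | (L) "\<forall>\<nu>\<in>orbit \<mu>. trR 1 \<nu> = 0" "\<forall>\<nu>\<in>orbit \<mu>. cubA \<nu> = 0"
      by blast
    then show ?thesis
    proof cases
      case R
      then obtain \<rho> where \<rho>: "\<rho> \<in> orbit \<mu>" "trR 1 \<rho> \<noteq> 0" by blast
      obtain \<nu> where \<nu>: "\<nu> \<in> orbit \<rho>" "trR 1 \<nu> = trR 1 \<rho>"
        "trR 2 \<nu> = trR 2 \<rho> + (- trR 2 \<rho> / trR 1 \<rho>) * trR 1 \<rho>"
        using orbit_shear_trace_cubic[OF A2[OF \<rho>(1)]] by metis
      have \<nu>\<mu>: "\<nu> \<in> orbit \<mu>" using \<nu>(1) \<rho>(1) orbit_trans by blast
      have r: "trR 1 \<nu> \<noteq> 0" "trR 2 \<nu> = 0" using \<nu>(2,3) \<rho>(2) by auto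
      note e = T08_closure_eqs[OF E[OF \<nu>\<mu>]]
      have "trR 1 \<nu> * (trR 1 \<nu> + 2 * cubB \<nu>) = 0"
        using e(4) r by (simp add: algebra_simps)
      then have "trR 1 \<nu> = - 2 * cubB \<nu>"
        using r by (simp add: add_eq_0_iff2)
      then show ?thesis using e(5,6,8) r \<nu>\<mu> by auto
    next
      case cub
      then obtain \<rho> where \<rho>: "\<rho> \<in> orbit \<mu>" "cubA \<rho> \<noteq> 0" by blast
      have r: "trR 1 \<nu> = 0" "trR 2 \<nu> = 0" if "\<nu> \<in> orbit \<mu>" for \<nu>
        using cub(1) that orbit_swap_trace_cubic[OF A2[OF that]] orbit_trans by metis+
      \<comment> \<open>With \<open>trR\<close> zero the Hessian vanishes, so the cubic form is a
        multiple of a cube; \<open>t\<close> is its triple root.\<close>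
      define t where "t = - cubB \<rho> / (3 * cubA \<rho>)"
      have t: "3 * cubA \<rho> * t = - cubB \<rho>" using \<rho>(2) by (simp add: t_def)
      have h: "cubB \<rho> * cubB \<rho> = 3 * (cubA \<rho> * cubC \<rho>)" "cubB \<rho> * cubC \<rho> = 9 * (cubA \<rho> * cubD \<rho>)"
        using T08_closure_eqs(1,2)[OF E[OF \<rho>(1)]] r[OF \<rho>(1)] by simp_all
      obtain \<nu> where \<nu>: "\<nu> \<in> orbit \<rho>" "cubA \<nu> = cubA \<rho>"
        "cubD \<nu> = cubD \<rho> + t * cubC \<rho> + t * t * cubB \<rho> + t * t * t * cubA \<rho>"
        using orbit_shear_trace_cubic[OF A2[OF \<rho>(1)], of t] by metis
      have \<nu>\<mu>: "\<nu> \<in> orbit \<mu>" using \<nu>(1) \<rho>(1) orbit_trans by blast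
      have "27 * (cubA \<rho> * cubA \<rho> * cubD \<nu>) = 0"
        unfolding \<nu>(3) using t h by algebra
      then have D: "cubD \<nu> = 0" using \<rho>(2) by simp
      note e = T08_closure_eqs[OF E[OF \<nu>\<mu>]]
      have C: "cubC \<nu> = 0" using e(3) r[OF \<nu>\<mu>] D by simp
      then have B: "cubB \<nu> = 0" using e(1) r[OF \<nu>\<mu>] by simp
      then have "trL 2 \<nu> = 0" using e(7) r[OF \<nu>\<mu>] \<nu>(2) \<rho>(2) by simp
      then show ?thesis using B C D r[OF \<nu>\<mu>] \<nu>\<mu> by auto
    next
      case L
      have r: "trR 1 \<nu> = 0" "trR 2 \<nu> = 0" if "\<nu> \<in> orbit \<mu>" for \<nu>
        using L(1) that orbit_swap_trace_cubic[OF A2[OF that]] orbit_trans by metis+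
      have c: "cubB \<nu> = 0" "cubC \<nu> = 0" "cubD \<nu> = 0" if "\<nu> \<in> orbit \<mu>" for \<nu>
      proof -
        have A: "cubA \<nu> = 0" using L(2) that by blast
        show D: "cubD \<nu> = 0"
          using L(2) that orbit_swap_trace_cubic[OF A2[OF that]] orbit_trans by (metis neg_equal_0_iff_equal)
        show "cubB \<nu> = 0" "cubC \<nu> = 0"
          using T08_closure_eqs(1,3)[OF E[OF that]] r[OF that] A D by simp_all
      qed
      \<comment> \<open>Only \<open>trL\<close> may be nonzero now, so e2 just has to be placed in
        its kernel.\<close>
      have "\<exists>\<nu>\<in>orbit \<mu>. trL 2 \<nu> = 0"
      proof (cases "trL 1 \<mu> = 0")
        case True
        then show ?thesis using orbit_swap_trace_cubic[OF A2[OF orbit_refl]] by metis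
      next
        case False
        obtain \<nu> where "\<nu> \<in> orbit \<mu>" "trL 2 \<nu> = trL 2 \<mu> + (- trL 2 \<mu> / trL 1 \<mu>) * trL 1 \<mu>"
          using orbit_shear_trace_cubic[OF A2[OF orbit_refl]] by metis
        then show ?thesis using False by auto
      qed
      then show ?thesis using r c by auto
    qed
  qed
  then show ?thesis using trace_cubic_eq_tri A2 by metis
qed

lemma tri_in_T08_closure:
  "orbit (tri l c a (3 * l - 2 * (a::'a::field_char_0))) \<subseteq> orbit_closure T08_family"
\<comment> \<open>The slope 3 preserves b = 3 l - 2 a. Excluded are l + t = 0 and the parameters 2
  and 3/2.\<close>
proof (rule orbit_tri_in_closure[where d = 3 and E = "{- l, a / 2 - l, 2 * a / 3 - l}"])
  fix t assume "t \<notin> {- l, a / 2 - l, 2 * a / 3 - l}"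
  moreover have "t = - l" if "l + t = 0"
    using that by (simp add: add_eq_0_iff)
  moreover have "t = a / 2 - l" if "a = 2 * (l + t)"
    unfolding that by (simp add: add_divide_distrib)
  moreover have "t = 2 * a / 3 - l" if "2 * a = 3 * (l + t)"
    unfolding that by (simp add: add_divide_distrib)
  ultimately have t: "l + t \<noteq> 0" "a \<noteq> 2 * (l + t)" "2 * a \<noteq> 3 * (l + t)"
    by blast+
  have "orbit (tri 1 0 (a / (l + t)) (3 - 2 * (a / (l + t)))) =
      orbit (tri (l + t) c a (3 * l - 2 * a + t * 3))"
    by (rule orbit_tri_scale[where k = "1 / (l + t)"]) (use t in \<open>auto simp: field_simps\<close>)
  then have "tri (l + t) c a (3 * l - 2 * a + t * 3) \<in> orbit (T08 (a / (l + t)))"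
    unfolding T08_tri by simp
  moreover have "T08 (a / (l + t)) \<in> T08_family"
    using t by (auto simp: T08_family_def field_simps)
  ultimately show "\<exists>\<tau>\<in>T08_family. tri (l + t) c a (3 * l - 2 * a + t * 3) \<in> orbit \<tau>" by auto
qed (simp, intro disjI2 disjI1, simp add: algebra_simps)

lemma T08_closure_iff:
  "orbit \<mu> \<subseteq> orbit_closure T08_family \<longleftrightarrow>
     (\<exists>l c a. orbit (tri l c a (3 * l - 2 * (a::'a::field_char_0))) = orbit \<mu>)"
  using T08_closure_tri tri_in_T08_closure orbit_eq by metis


subsection \<open>Normal forms\<close>

lemma T07_normal_form:
  fixes l c a :: "'a::field_char_0"
  shows "\<exists>\<nu> \<in> {T07 \<alpha> |\<alpha>. \<alpha> \<noteq> 1} \<union> {T03, T01, T04, T10 1, zero_mult}. orbit \<nu> = orbit (tri l c a 0)"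
proof -
  consider "l \<noteq> 0" "a \<noteq> l" | "l \<noteq> 0" "a = l" "c \<noteq> 0" | "l \<noteq> 0" "a = l" "c = 0"
    | "l = 0" "a \<noteq> 0" | "l = 0" "a = 0" "c \<noteq> 0" | "l = 0" "a = 0" "c = 0" by blast
  then show ?thesis
  proof cases
    case 1
    then have "orbit (T07 (a / l)) = orbit (tri l c a 0)"
      unfolding T07_tri by (intro orbit_tri_scale[where k = "1 / l"]) simp_all
    moreover have "a / l \<noteq> 1" using 1 by simp
    ultimately show ?thesis by blast
  next
    case 2
    then have "orbit T01 = orbit (tri l c a 0)"
      unfolding T01_tri by (intro orbit_tri_scale_1[where k = "1 / l"]) simp_all
    then show ?thesis by blast
  next
    case 3
    then have "orbit (T10 1) = orbit (tri l c a 0)"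
      unfolding orbit_T10 by (intro orbit_tri_scale[where k = "1 / l"]) simp_all
    then show ?thesis by blast
  next
    case 4
    then have "orbit T04 = orbit (tri l c a 0)"
      unfolding orbit_T04 by (intro orbit_tri_scale[where k = "1 / a"]) simp_all
    then show ?thesis by blast
  next
    case 5
    then have "orbit T03 = orbit (tri l c a 0)"
      unfolding T03_tri by (intro orbit_tri_scale_1[where k = 1]) simp_all
    then show ?thesis by blast
  next
    case 6
    then show ?thesis by (simp add: zero_mult_tri)
  qed
qed

lemma T07_list_tri:
  fixes \<nu> :: "'a::field_char_0 mult"
  assumes "\<nu> \<in> {T07 \<alpha> |\<alpha>. \<alpha> \<noteq> 1} \<union> {T03, T01, T04, T10 1, zero_mult}"
  shows "\<exists>l c a. orbit (tri l c a 0) = orbit \<nu>"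
  using assms by (auto simp: T07_tri T03_tri T01_tri orbit_T04 orbit_T10 zero_mult_tri) blast+

lemma T08_normal_form:
  fixes l c a :: "'a::field_char_0"
  shows "\<exists>\<nu> \<in> {T08 \<alpha> |\<alpha>. \<alpha> \<notin> {2, 3/2}} \<union> {T03, T02, T05, T10 2, T07 (3/2), zero_mult}.
    orbit \<nu> = orbit (tri l c a (3 * l - 2 * a))"
proof -
  \<comment> \<open>On a = 2 l one has a + b = l, so \<open>c\<close> matters; on a = 3/2 l one has
    b = 0, which gives a member of T07. For l = 0 the pair is (a, -2 a).\<close>
  consider "l \<noteq> 0" "a \<noteq> 2 * l" "a \<noteq> 3 / 2 * l" | "l \<noteq> 0" "a = 3 / 2 * l"
    | "l \<noteq> 0" "a = 2 * l" "c \<noteq> 0" | "l \<noteq> 0" "a = 2 * l" "c = 0"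
    | "l = 0" "a \<noteq> 0" | "l = 0" "a = 0" "c \<noteq> 0" | "l = 0" "a = 0" "c = 0" by blast
  then show ?thesis
  proof cases
    case 1
    then have "orbit (T08 (a / l)) = orbit (tri l c a (3 * l - 2 * a))"
      unfolding T08_tri by (intro orbit_tri_scale[where k = "1 / l"]) (auto simp: field_simps)
    moreover have "a / l \<notin> {2, 3/2}" using 1 by (auto simp: field_simps)
    ultimately show ?thesis by blast
  next
    case 2
    then have "orbit (T07 (3/2)) = orbit (tri l c a (3 * l - 2 * a))"
      unfolding T07_tri by (intro orbit_tri_scale[where k = "1 / l"]) (auto simp: field_simps)
    then show ?thesis by blast
  next
    case 3
    then have "orbit T02 = orbit (tri l c a (3 * l - 2 * a))"
      unfolding T02_tri by (intro orbit_tri_scale_1[where k = "1 / l"]) (auto simp: field_simps)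
    then show ?thesis by blast
  next
    case 4
    then have "orbit (T10 2) = orbit (tri l c a (3 * l - 2 * a))"
      unfolding orbit_T10 by (intro orbit_tri_scale[where k = "1 / l"]) (auto simp: field_simps)
    then show ?thesis by blast
  next
    case 5
    then have "orbit T05 = orbit (tri l c a (3 * l - 2 * a))"
      unfolding orbit_T05 by (intro orbit_tri_scale[where k = "- 1 / a"]) auto
    then show ?thesis by blast
  next
    case 6
    then have "orbit T03 = orbit (tri l c a (3 * l - 2 * a))"
      unfolding T03_tri by (intro orbit_tri_scale_1[where k = 1]) simp_all
    then show ?thesis by blast
  next
    case 7
    then show ?thesis by (simp add: zero_mult_tri)
  qed
qed

lemma T08_list_tri:
  fixes \<nu> :: "'a::field_char_0 mult"
  assumes "\<nu> \<in> {T08 \<alpha> |\<alpha>. \<alpha> \<notin> {2, 3/2}} \<union> {T03, T02, T05, T10 2, T07 (3/2), zero_mult}"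
  shows "\<exists>l c a. orbit (tri l c a (3 * l - 2 * a)) = orbit \<nu>"
proof -
  consider \<alpha> where "\<nu> = T08 \<alpha>" | "\<nu> = T03" | "\<nu> = T02" | "\<nu> = T05" | "\<nu> = T10 2"
    | "\<nu> = T07 (3/2)" | "\<nu> = zero_mult" using assms by blast
  then show ?thesis
  proof cases
    case 1
    then show ?thesis
      unfolding T08_tri by (intro exI[of _ 1] exI[of _ 0] exI[of _ \<alpha>]) simp
  next
    case 2
    then show ?thesis
      unfolding T03_tri by (intro exI[of _ 0] exI[of _ 1] exI[of _ 0]) simp
  next
    case 3
    then show ?thesis
      unfolding T02_tri by (intro exI[of _ 1] exI[of _ 1] exI[of _ 2]) simp
  next
    case 4
    then show ?thesis
      by (intro exI[of _ 0] exI[of _ 0] exI[of _ "-1"]) (simp add: orbit_T05)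
  next
    case 5
    then show ?thesis
      by (intro exI[of _ 1] exI[of _ 0] exI[of _ 2]) (simp add: orbit_T10)
  next
    case 6
    then show ?thesis
      unfolding T07_tri by (intro exI[of _ 1] exI[of _ 0] exI[of _ "3/2"]) simp
  next
    case 7
    then show ?thesis
      unfolding zero_mult_tri by (intro exI[of _ 0]) simp
  qed
qed

lemma T10_normal_form:
  fixes a b :: "'a::field_char_0"
  shows "\<exists>\<nu> \<in> {T10 \<alpha> |\<alpha>. True} \<union> {T06, zero_mult}. orbit \<nu> = orbit (tri (a + b) 0 a b)"
proof -
  consider "a + b \<noteq> 0" | "b = - a" "a \<noteq> 0" | "a = 0" "b = 0"
    by (metis add_eq_0_iff neg_equal_0_iff_equal)
  then show ?thesis
  proof cases
    case 1
    then have "orbit (T10 (a / (a + b))) = orbit (tri (a + b) 0 a b)"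
      unfolding orbit_T10 by (intro orbit_tri_scale[where k = "1 / (a + b)"]) (auto simp: field_simps)
    then show ?thesis by blast
  next
    case 2
    then have "orbit T06 = orbit (tri (a + b) 0 a b)"
      unfolding T06_tri by (intro orbit_tri_scale[where k = "1 / a"]) simp_all
    then show ?thesis by blast
  next
    case 3
    then show ?thesis by (simp add: zero_mult_tri)
  qed
qed

lemma T10_list_tri:
  fixes \<nu> :: "'a::field_char_0 mult"
  assumes "\<nu> \<in> {T10 \<alpha> |\<alpha>. True} \<union> {T06, zero_mult}"
  shows "\<exists>a b. orbit (tri (a + b) 0 a b) = orbit \<nu>"
proof -
  consider \<alpha> where "\<nu> = T10 \<alpha>" | "\<nu> = T06" | "\<nu> = zero_mult" using assms by blast
  then show ?thesis
  proof cases
    case 1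
    then show ?thesis
      by (intro exI[of _ \<alpha>] exI[of _ "1 - \<alpha>"]) (simp add: orbit_T10)
  next
    case 2
    then show ?thesis
      unfolding T06_tri by (intro exI[of _ 1] exI[of _ "-1"]) simp
  next
    case 3
    then show ?thesis
      unfolding zero_mult_tri by (intro exI[of _ 0]) simp
  qed
qed

lemma isomorphic_iff_orbit_eq: "isomorphic \<mu> \<nu> \<longleftrightarrow> orbit \<nu> = orbit \<mu>"
proof
  show "isomorphic \<mu> \<nu> \<Longrightarrow> orbit \<nu> = orbit \<mu>"
    unfolding isomorphic_iff_orbit by (rule orbit_eq)
  assume "orbit \<nu> = orbit \<mu>"
  then show "isomorphic \<mu> \<nu>"
    using orbit_refl[of \<nu>] by (simp only: isomorphic_iff_orbit)
qed

theorem theorem16: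
  fixes \<mu> :: "'k::{alg_closed_field, field_char_0} mult"
  assumes "\<mu> \<in> A2"
  shows "(orbit \<mu> \<subseteq> orbit_closure T07_family \<longleftrightarrow>
           (\<exists>\<nu> \<in> {T07 \<alpha> |\<alpha>. \<alpha> \<noteq> 1} \<union> {T03, T01, T04, T10 1, zero_mult}. isomorphic \<mu> \<nu>))
       \<and> (orbit \<mu> \<subseteq> orbit_closure T08_family \<longleftrightarrow>
           (\<exists>\<nu> \<in> {T08 \<alpha> |\<alpha>. \<alpha> \<notin> {2, 3/2}} \<union> {T03, T02, T05, T10 2, T07 (3/2), zero_mult}.
              isomorphic \<mu> \<nu>))
       \<and> (orbit \<mu> \<subseteq> orbit_closure T10_family \<longleftrightarrow>
           (\<exists>\<nu> \<in> {T10 \<alpha> |\<alpha>. True} \<union> {T06, zero_mult}. isomorphic \<mu> \<nu>))"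
  unfolding isomorphic_iff_orbit_eq T07_closure_iff T08_closure_iff T10_closure_iff
proof (intro conjI)
  show "(\<exists>l c a. orbit (tri l c a 0) = orbit \<mu>) \<longleftrightarrow>
      (\<exists>\<nu> \<in> {T07 \<alpha> |\<alpha>. \<alpha> \<noteq> 1} \<union> {T03, T01, T04, T10 1, zero_mult}. orbit \<nu> = orbit \<mu>)" (is "?L \<longleftrightarrow> ?R")
  proof
    assume ?L
    then obtain l c a where e: "orbit (tri l c a 0) = orbit \<mu>" by blast
    show ?R using T07_normal_form[of l c a] unfolding e .
  next
    assume ?R
    then obtain \<nu> where \<nu>: "\<nu> \<in> {T07 \<alpha> |\<alpha>. \<alpha> \<noteq> 1} \<union> {T03, T01, T04, T10 1, zero_mult}"
      and e: "orbit \<nu> = orbit \<mu>" by (rule bexE)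
    show ?L using T07_list_tri[OF \<nu>] unfolding e .
  qed
next
  show "(\<exists>l c a. orbit (tri l c a (3 * l - 2 * a)) = orbit \<mu>) \<longleftrightarrow>
      (\<exists>\<nu> \<in> {T08 \<alpha> |\<alpha>. \<alpha> \<notin> {2, 3/2}} \<union> {T03, T02, T05, T10 2, T07 (3/2), zero_mult}. orbit \<nu> = orbit \<mu>)" (is "?L \<longleftrightarrow> ?R")
  proof
    assume ?L
    then obtain l c a where e: "orbit (tri l c a (3 * l - 2 * a)) = orbit \<mu>" by blast
    show ?R using T08_normal_form[of l c a] unfolding e .
  next
    assume ?R
    then obtain \<nu> where \<nu>: "\<nu> \<in> {T08 \<alpha> |\<alpha>. \<alpha> \<notin> {2, 3/2}} \<union> {T03, T02, T05, T10 2, T07 (3/2), zero_mult}"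
      and e: "orbit \<nu> = orbit \<mu>" by (rule bexE)
    show ?L using T08_list_tri[OF \<nu>] unfolding e .
  qed
next
  show "(\<exists>a b. orbit (tri (a + b) 0 a b) = orbit \<mu>) \<longleftrightarrow>
      (\<exists>\<nu> \<in> {T10 \<alpha> |\<alpha>. True} \<union> {T06, zero_mult}. orbit \<nu> = orbit \<mu>)" (is "?L \<longleftrightarrow> ?R")
  proof
    assume ?L
    then obtain a b where e: "orbit (tri (a + b) 0 a b) = orbit \<mu>" by blast
    show ?R using T10_normal_form[of a b] unfolding e .
  next
    assume ?R
    then obtain \<nu> where \<nu>: "\<nu> \<in> {T10 \<alpha> |\<alpha>. True} \<union> {T06, zero_mult}"
      and e: "orbit \<nu> = orbit \<mu>" by (rule bexE)
    show ?L using T10_list_tri[OF \<nu>] unfolding e .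
  qed
qed

end
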